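(* Let $k$ be an algebraically closed field of characteristic $2$. Then the group algebra $kA_4$ has exactly one block, namely $kA_4$ itself.
   Context: For a finite-dimensional algebra $A$, write $1=e_1+\cdots+e_n$ as the (unique) sum of primitive central orthogonal idempotents; the blocks of $A$ are the two-sided ideals $Ae_1,\dots,Ae_n$, i.e. the indecomposable two-sided ideal direct summands of $A$. *)

theory Defs
  imports "HOL-Algebra.Algebra"
begin

section \<open>Characteristic and group algebras\<close>

definition ring_char :: "('a, 'm) ring_scheme \<Rightarrow> nat"
  where "ring_char R = group.ord (add_monoid R) \<one>\<^bsub>R\<^esub>"
  \<comment> \<open>\<^const>\<open>group.ord\<close> is \<open>0\<close> on elements of infinite order.\<close>

text \<open>
  For a finite group \<open>G\<close>, the element \<open>\<Sum>\<^sub>g a\<^sub>g g\<close> of \<open>kG\<close> is the function \<open>g \<mapsto> a\<^sub>g\<close>, extended by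
  \<^const>\<open>undefined\<close> outside \<open>carrier G\<close>; the coefficient of a product at \<open>x\<close> collects the pairs
  \<open>(y, y\<^sup>-\<^sup>1 x)\<close>. For infinite \<open>G\<close> this is not the group algebra.
\<close>

definition group_algebra ::
    "('a, 'm) ring_scheme \<Rightarrow> ('g, 'n) monoid_scheme \<Rightarrow> ('a, 'g \<Rightarrow> 'a) module"
  where "group_algebra k G =
    \<lparr> carrier = carrier G \<rightarrow>\<^sub>E carrier k,
      monoid.mult = (\<lambda>a b. \<lambda>x\<in>carrier G.
                \<Oplus>\<^bsub>k\<^esub>y\<in>carrier G. a y \<otimes>\<^bsub>k\<^esub> b (inv\<^bsub>G\<^esub> y \<otimes>\<^bsub>G\<^esub> x)),
      monoid.one = (\<lambda>x\<in>carrier G. if x = \<one>\<^bsub>G\<^esub> then \<one>\<^bsub>k\<^esub> else \<zero>\<^bsub>k\<^esub>),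
      ring.zero = (\<lambda>x\<in>carrier G. \<zero>\<^bsub>k\<^esub>),
      ring.add = (\<lambda>a b. \<lambda>x\<in>carrier G. a x \<oplus>\<^bsub>k\<^esub> b x),
      smult = (\<lambda>c a. \<lambda>x\<in>carrier G. c \<otimes>\<^bsub>k\<^esub> a x) \<rparr>"

lemma (in abelian_monoid) finsum_swap:
  assumes "finite I" "finite J" "\<And>i j. i \<in> I \<Longrightarrow> j \<in> J \<Longrightarrow> f i j \<in> carrier G"
  shows "(\<Oplus>i\<in>I. \<Oplus>j\<in>J. f i j) = (\<Oplus>j\<in>J. \<Oplus>i\<in>I. f i j)"
  using assms(1,3)
proof (induction I rule: finite_induct)
  case empty
  then show ?case by (simp add: finsum_zero)
next
  case (insert a I)
  have "(\<Oplus>j\<in>J. \<Oplus>i\<in>insert a I. f i j) = (\<Oplus>j\<in>J. f a j \<oplus> (\<Oplus>i\<in>I. f i j))"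
    using insert by (intro finsum_cong') (auto simp: Pi_def intro!: finsum_closed)
  also have "\<dots> = (\<Oplus>j\<in>J. f a j) \<oplus> (\<Oplus>j\<in>J. \<Oplus>i\<in>I. f i j)"
    using insert by (intro finsum_addf) (auto simp: Pi_def intro!: finsum_closed)
  finally show ?case
    using insert by (simp add: Pi_def)
qed

lemma group_algebra_ring:
  assumes "cring k" "group G" "finite (carrier G)"
  shows "ring (group_algebra k G)"
proof -
  interpret k: cring k by fact
  interpret G: group G by fact
  note fin = assms(3)
  let ?A = "group_algebra k G"
  have car: "carrier ?A = carrier G \<rightarrow>\<^sub>E carrier k" by (simp add: group_algebra_def)
  have ext: "a = b" if "a \<in> carrier ?A" "b \<in> carrier ?A" "\<And>x. x \<in> carrier G \<Longrightarrow> a x = b x" for a b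
    using that unfolding car by (meson PiE_ext)
  have val: "a x \<in> carrier k" if "a \<in> carrier ?A" "x \<in> carrier G" for a x
    using that unfolding car by auto
  have mul: "(a \<otimes>\<^bsub>?A\<^esub> b) x = (\<Oplus>\<^bsub>k\<^esub>y\<in>carrier G. a y \<otimes>\<^bsub>k\<^esub> b (inv\<^bsub>G\<^esub> y \<otimes>\<^bsub>G\<^esub> x))"
    if "x \<in> carrier G" for a b x using that by (simp add: group_algebra_def)
  have pls: "(a \<oplus>\<^bsub>?A\<^esub> b) x = a x \<oplus>\<^bsub>k\<^esub> b x" if "x \<in> carrier G" for a b x
    using that by (simp add: group_algebra_def)
  have zer: "\<zero>\<^bsub>?A\<^esub> x = \<zero>\<^bsub>k\<^esub>" if "x \<in> carrier G" for x
    using that by (simp add: group_algebra_def)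
  have one: "\<one>\<^bsub>?A\<^esub> x = (if x = \<one>\<^bsub>G\<^esub> then \<one>\<^bsub>k\<^esub> else \<zero>\<^bsub>k\<^esub>)" if "x \<in> carrier G" for x
    using that by (simp add: group_algebra_def)
  have mulc: "a \<otimes>\<^bsub>?A\<^esub> b \<in> carrier ?A" if "a \<in> carrier ?A" "b \<in> carrier ?A" for a b
    using that val unfolding group_algebra_def by (auto intro!: k.finsum_closed k.m_closed)
  have plsc: "a \<oplus>\<^bsub>?A\<^esub> b \<in> carrier ?A" if "a \<in> carrier ?A" "b \<in> carrier ?A" for a b
    using that val unfolding group_algebra_def by (auto intro!: k.a_closed)
  have zerc: "\<zero>\<^bsub>?A\<^esub> \<in> carrier ?A" and onec: "\<one>\<^bsub>?A\<^esub> \<in> carrier ?A"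
    unfolding group_algebra_def by auto
  show ?thesis
  proof (rule ringI)
    show "abelian_group ?A"
    proof (rule abelian_groupI)
      fix a assume a: "a \<in> carrier ?A"
      have "(\<lambda>x\<in>carrier G. \<ominus>\<^bsub>k\<^esub> a x) \<in> carrier ?A"
        using a val unfolding car by auto
      moreover from this have "(\<lambda>x\<in>carrier G. \<ominus>\<^bsub>k\<^esub> a x) \<oplus>\<^bsub>?A\<^esub> a = \<zero>\<^bsub>?A\<^esub>"
        using a val by (intro ext) (auto simp: pls zer plsc zerc k.l_neg)
      ultimately show "\<exists>y\<in>carrier ?A. y \<oplus>\<^bsub>?A\<^esub> a = \<zero>\<^bsub>?A\<^esub>" by blast
    next
      fix a b c assume a: "a \<in> carrier ?A" and b: "b \<in> carrier ?A" and c: "c \<in> carrier ?A"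
      show "a \<oplus>\<^bsub>?A\<^esub> b \<in> carrier ?A" by (rule plsc[OF a b])
      show "a \<oplus>\<^bsub>?A\<^esub> b \<oplus>\<^bsub>?A\<^esub> c = a \<oplus>\<^bsub>?A\<^esub> (b \<oplus>\<^bsub>?A\<^esub> c)"
        by (rule ext) (simp_all add: a b c plsc pls val k.a_assoc)
      show "a \<oplus>\<^bsub>?A\<^esub> b = b \<oplus>\<^bsub>?A\<^esub> a"
        by (rule ext) (simp_all add: a b plsc pls val k.a_comm)
      show "\<zero>\<^bsub>?A\<^esub> \<oplus>\<^bsub>?A\<^esub> a = a"
        by (rule ext) (simp_all add: a plsc zerc pls zer val)
    qed (rule zerc)
    show "monoid ?A"
    proof (rule monoidI)
      fix a b c assume a: "a \<in> carrier ?A" and b: "b \<in> carrier ?A" and c: "c \<in> carrier ?A"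
      show "a \<otimes>\<^bsub>?A\<^esub> b \<otimes>\<^bsub>?A\<^esub> c = a \<otimes>\<^bsub>?A\<^esub> (b \<otimes>\<^bsub>?A\<^esub> c)"
      proof (rule ext)
        fix x assume x: "x \<in> carrier G"
        let ?f = "\<lambda>y z. a y \<otimes>\<^bsub>k\<^esub> b (inv\<^bsub>G\<^esub> y \<otimes>\<^bsub>G\<^esub> z) \<otimes>\<^bsub>k\<^esub> c (inv\<^bsub>G\<^esub> z \<otimes>\<^bsub>G\<^esub> x)"
        have "(a \<otimes>\<^bsub>?A\<^esub> b \<otimes>\<^bsub>?A\<^esub> c) x = (\<Oplus>\<^bsub>k\<^esub>z\<in>carrier G. \<Oplus>\<^bsub>k\<^esub>y\<in>carrier G. ?f y z)"
          unfolding mul[OF x] using a b c x val fin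
          by (intro k.finsum_cong')
             (auto simp: mul k.finsum_ldistr Pi_def intro!: k.finsum_closed)
        also have "\<dots> = (\<Oplus>\<^bsub>k\<^esub>y\<in>carrier G. \<Oplus>\<^bsub>k\<^esub>z\<in>carrier G. ?f y z)"
          using a b c x val fin by (intro k.finsum_swap) auto
        also have "\<dots> = (a \<otimes>\<^bsub>?A\<^esub> (b \<otimes>\<^bsub>?A\<^esub> c)) x"
          unfolding mul[OF x]
        proof (intro k.finsum_cong' refl)
          fix y assume y: "y \<in> carrier G"
          have bij: "bij_betw (\<lambda>w. y \<otimes>\<^bsub>G\<^esub> w) (carrier G) (carrier G)"
            using y by (simp add: bij_betw_def G.inj_on_cmult G.surj_const_mult)
          have "(\<Oplus>\<^bsub>k\<^esub>z\<in>carrier G. ?f y z) = (\<Oplus>\<^bsub>k\<^esub>z\<in>(\<lambda>w. y \<otimes>\<^bsub>G\<^esub> w) ` carrier G. ?f y z)"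
            using bij by (simp add: bij_betw_def)
          also have "\<dots> = (\<Oplus>\<^bsub>k\<^esub>w\<in>carrier G. ?f y (y \<otimes>\<^bsub>G\<^esub> w))"
            using a b c x y val bij
            by (intro k.finsum_reindex) (auto simp: bij_betw_def)
          also have "\<dots> = (\<Oplus>\<^bsub>k\<^esub>w\<in>carrier G.
              a y \<otimes>\<^bsub>k\<^esub> (b w \<otimes>\<^bsub>k\<^esub> c (inv\<^bsub>G\<^esub> w \<otimes>\<^bsub>G\<^esub> (inv\<^bsub>G\<^esub> y \<otimes>\<^bsub>G\<^esub> x))))"
          proof (intro k.finsum_cong' refl)
            fix w assume w: "w \<in> carrier G"
            have "inv\<^bsub>G\<^esub> y \<otimes>\<^bsub>G\<^esub> (y \<otimes>\<^bsub>G\<^esub> w) = w"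
              using y w by (simp flip: G.m_assoc)
            moreover have "inv\<^bsub>G\<^esub> (y \<otimes>\<^bsub>G\<^esub> w) \<otimes>\<^bsub>G\<^esub> x = inv\<^bsub>G\<^esub> w \<otimes>\<^bsub>G\<^esub> (inv\<^bsub>G\<^esub> y \<otimes>\<^bsub>G\<^esub> x)"
              using y w x by (simp add: G.inv_mult_group G.m_assoc)
            ultimately show "?f y (y \<otimes>\<^bsub>G\<^esub> w) =
                a y \<otimes>\<^bsub>k\<^esub> (b w \<otimes>\<^bsub>k\<^esub> c (inv\<^bsub>G\<^esub> w \<otimes>\<^bsub>G\<^esub> (inv\<^bsub>G\<^esub> y \<otimes>\<^bsub>G\<^esub> x)))"
              using y w x a b c val by (simp add: k.m_assoc)
          qed (use a b c x y val in auto)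
          also have "\<dots> = a y \<otimes>\<^bsub>k\<^esub> (b \<otimes>\<^bsub>?A\<^esub> c) (inv\<^bsub>G\<^esub> y \<otimes>\<^bsub>G\<^esub> x)"
            using a b c x y val fin by (simp add: mul k.finsum_rdistr Pi_def)
          finally show "(\<Oplus>\<^bsub>k\<^esub>z\<in>carrier G. ?f y z) = a y \<otimes>\<^bsub>k\<^esub> (b \<otimes>\<^bsub>?A\<^esub> c) (inv\<^bsub>G\<^esub> y \<otimes>\<^bsub>G\<^esub> x)" .
        qed (use a val mulc[OF b c] x in auto)
        finally show "(a \<otimes>\<^bsub>?A\<^esub> b \<otimes>\<^bsub>?A\<^esub> c) x = (a \<otimes>\<^bsub>?A\<^esub> (b \<otimes>\<^bsub>?A\<^esub> c)) x" .
      qed (use a b c mulc in auto)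
    next
      fix a assume a: "a \<in> carrier ?A"
      show "\<one>\<^bsub>?A\<^esub> \<otimes>\<^bsub>?A\<^esub> a = a"
      proof (rule ext)
        fix x assume x: "x \<in> carrier G"
        have "(\<one>\<^bsub>?A\<^esub> \<otimes>\<^bsub>?A\<^esub> a) x =
            (\<Oplus>\<^bsub>k\<^esub>y\<in>carrier G. if \<one>\<^bsub>G\<^esub> = y then a (inv\<^bsub>G\<^esub> y \<otimes>\<^bsub>G\<^esub> x) else \<zero>\<^bsub>k\<^esub>)"
          unfolding mul[OF x] using a x val by (intro k.finsum_cong') (auto simp: one)
        also have "\<dots> = a x"
          using k.finsum_singleton[of "\<one>\<^bsub>G\<^esub>" "carrier G" "\<lambda>y. a (inv\<^bsub>G\<^esub> y \<otimes>\<^bsub>G\<^esub> x)"] fin a x val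
          by auto
        finally show "(\<one>\<^bsub>?A\<^esub> \<otimes>\<^bsub>?A\<^esub> a) x = a x" .
      qed (use a mulc onec in auto)
      show "a \<otimes>\<^bsub>?A\<^esub> \<one>\<^bsub>?A\<^esub> = a"
      proof (rule ext)
        fix x assume x: "x \<in> carrier G"
        have *: "inv\<^bsub>G\<^esub> y \<otimes>\<^bsub>G\<^esub> x = \<one>\<^bsub>G\<^esub> \<longleftrightarrow> x = y" if "y \<in> carrier G" for y
          using that x by (metis G.inv_closed G.inv_equality G.inv_inv G.l_inv)
        have "(a \<otimes>\<^bsub>?A\<^esub> \<one>\<^bsub>?A\<^esub>) x = (\<Oplus>\<^bsub>k\<^esub>y\<in>carrier G. if x = y then a y else \<zero>\<^bsub>k\<^esub>)"
          unfolding mul[OF x] using a x val by (intro k.finsum_cong') (auto simp: one *)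
        also have "\<dots> = a x"
          using k.finsum_singleton[of x "carrier G" a] fin a x val by auto
        finally show "(a \<otimes>\<^bsub>?A\<^esub> \<one>\<^bsub>?A\<^esub>) x = a x" .
      qed (use a mulc onec in auto)
    qed (use mulc onec in auto)
    fix a b c assume a: "a \<in> carrier ?A" and b: "b \<in> carrier ?A" and c: "c \<in> carrier ?A"
    show "(a \<oplus>\<^bsub>?A\<^esub> b) \<otimes>\<^bsub>?A\<^esub> c = a \<otimes>\<^bsub>?A\<^esub> c \<oplus>\<^bsub>?A\<^esub> b \<otimes>\<^bsub>?A\<^esub> c"
    proof (rule ext)
      fix x assume x: "x \<in> carrier G"
      have "((a \<oplus>\<^bsub>?A\<^esub> b) \<otimes>\<^bsub>?A\<^esub> c) x = (\<Oplus>\<^bsub>k\<^esub>y\<in>carrier G.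
          a y \<otimes>\<^bsub>k\<^esub> c (inv\<^bsub>G\<^esub> y \<otimes>\<^bsub>G\<^esub> x) \<oplus>\<^bsub>k\<^esub> b y \<otimes>\<^bsub>k\<^esub> c (inv\<^bsub>G\<^esub> y \<otimes>\<^bsub>G\<^esub> x))"
        unfolding mul[OF x] using a b c x val
        by (intro k.finsum_cong') (auto simp: pls k.l_distr)
      also have "\<dots> = (a \<otimes>\<^bsub>?A\<^esub> c \<oplus>\<^bsub>?A\<^esub> b \<otimes>\<^bsub>?A\<^esub> c) x"
        unfolding pls[OF x] mul[OF x] using a b c x val by (intro k.finsum_addf) auto
      finally show "((a \<oplus>\<^bsub>?A\<^esub> b) \<otimes>\<^bsub>?A\<^esub> c) x = (a \<otimes>\<^bsub>?A\<^esub> c \<oplus>\<^bsub>?A\<^esub> b \<otimes>\<^bsub>?A\<^esub> c) x" .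
    qed (use a b c mulc plsc in auto)
    show "c \<otimes>\<^bsub>?A\<^esub> (a \<oplus>\<^bsub>?A\<^esub> b) = c \<otimes>\<^bsub>?A\<^esub> a \<oplus>\<^bsub>?A\<^esub> c \<otimes>\<^bsub>?A\<^esub> b"
    proof (rule ext)
      fix x assume x: "x \<in> carrier G"
      have "(c \<otimes>\<^bsub>?A\<^esub> (a \<oplus>\<^bsub>?A\<^esub> b)) x = (\<Oplus>\<^bsub>k\<^esub>y\<in>carrier G.
          c y \<otimes>\<^bsub>k\<^esub> a (inv\<^bsub>G\<^esub> y \<otimes>\<^bsub>G\<^esub> x) \<oplus>\<^bsub>k\<^esub> c y \<otimes>\<^bsub>k\<^esub> b (inv\<^bsub>G\<^esub> y \<otimes>\<^bsub>G\<^esub> x))"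
        unfolding mul[OF x] using a b c x val
        by (intro k.finsum_cong') (auto simp: pls k.r_distr)
      also have "\<dots> = (c \<otimes>\<^bsub>?A\<^esub> a \<oplus>\<^bsub>?A\<^esub> c \<otimes>\<^bsub>?A\<^esub> b) x"
        unfolding pls[OF x] mul[OF x] using a b c x val by (intro k.finsum_addf) auto
      finally show "(c \<otimes>\<^bsub>?A\<^esub> (a \<oplus>\<^bsub>?A\<^esub> b)) x = (c \<otimes>\<^bsub>?A\<^esub> a \<oplus>\<^bsub>?A\<^esub> c \<otimes>\<^bsub>?A\<^esub> b) x" .
    qed (use a b c mulc plsc in auto)
  qed
qed

lemma group_algebra_module:
  assumes "cring k" "group G" "finite (carrier G)"
  shows "module k (group_algebra k G)"
proof -
  interpret k: cring k by fact
  interpret A: ring "group_algebra k G" by (rule group_algebra_ring[OF assms])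
  let ?A = "group_algebra k G"
  have car: "carrier ?A = carrier G \<rightarrow>\<^sub>E carrier k" by (simp add: group_algebra_def)
  have ext: "a = b" if "a \<in> carrier ?A" "b \<in> carrier ?A" "\<And>x. x \<in> carrier G \<Longrightarrow> a x = b x" for a b
    using that unfolding car by (meson PiE_ext)
  have val: "a x \<in> carrier k" if "a \<in> carrier ?A" "x \<in> carrier G" for a x
    using that unfolding car by auto
  have pls: "(a \<oplus>\<^bsub>?A\<^esub> b) x = a x \<oplus>\<^bsub>k\<^esub> b x" if "x \<in> carrier G" for a b x
    using that by (simp add: group_algebra_def)
  have sm: "(c \<odot>\<^bsub>?A\<^esub> a) x = c \<otimes>\<^bsub>k\<^esub> a x" if "x \<in> carrier G" for a c x
    using that by (simp add: group_algebra_def)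
  have smc: "c \<odot>\<^bsub>?A\<^esub> a \<in> carrier ?A" if "c \<in> carrier k" "a \<in> carrier ?A" for a c
    using that val unfolding group_algebra_def by (auto intro!: k.m_closed)
  show ?thesis
  proof (rule moduleI[OF assms(1) A.is_abelian_group])
    fix c d a
    assume c: "c \<in> carrier k" and a: "a \<in> carrier ?A"
    show "c \<odot>\<^bsub>?A\<^esub> a \<in> carrier ?A" by (rule smc[OF c a])
    assume d: "d \<in> carrier k"
    show "(c \<oplus>\<^bsub>k\<^esub> d) \<odot>\<^bsub>?A\<^esub> a = c \<odot>\<^bsub>?A\<^esub> a \<oplus>\<^bsub>?A\<^esub> d \<odot>\<^bsub>?A\<^esub> a"
      by (rule ext) (simp_all add: a c d smc sm val pls k.l_distr)
    show "(c \<otimes>\<^bsub>k\<^esub> d) \<odot>\<^bsub>?A\<^esub> a = c \<odot>\<^bsub>?A\<^esub> (d \<odot>\<^bsub>?A\<^esub> a)"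
      by (rule ext) (simp_all add: a c d smc sm val k.m_assoc)
  next
    fix c a b
    assume c: "c \<in> carrier k" and a: "a \<in> carrier ?A" and b: "b \<in> carrier ?A"
    show "c \<odot>\<^bsub>?A\<^esub> (a \<oplus>\<^bsub>?A\<^esub> b) = c \<odot>\<^bsub>?A\<^esub> a \<oplus>\<^bsub>?A\<^esub> c \<odot>\<^bsub>?A\<^esub> b"
      by (rule ext) (simp_all add: a b c smc sm val pls k.r_distr)
  next
    fix a assume a: "a \<in> carrier ?A"
    show "\<one>\<^bsub>k\<^esub> \<odot>\<^bsub>?A\<^esub> a = a"
      by (rule ext) (simp_all add: a smc sm val)
  qed
qed


section \<open>Blocks\<close>

definition central_idempotent :: "('a, 'm) ring_scheme \<Rightarrow> 'a \<Rightarrow> bool"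
  where "central_idempotent A e \<longleftrightarrow>
    e \<in> carrier A \<and> e \<otimes>\<^bsub>A\<^esub> e = e \<and> (\<forall>x\<in>carrier A. e \<otimes>\<^bsub>A\<^esub> x = x \<otimes>\<^bsub>A\<^esub> e)"

text \<open>Primitive among the central idempotents, i.e. primitive in the centre of \<open>A\<close>.\<close>

definition primitive_central_idempotent :: "('a, 'm) ring_scheme \<Rightarrow> 'a \<Rightarrow> bool"
  where "primitive_central_idempotent A e \<longleftrightarrow>
    central_idempotent A e \<and> e \<noteq> \<zero>\<^bsub>A\<^esub> \<and>
    (\<forall>f g. central_idempotent A f \<longrightarrow> central_idempotent A g \<longrightarrow>
       f \<otimes>\<^bsub>A\<^esub> g = \<zero>\<^bsub>A\<^esub> \<longrightarrow> e = f \<oplus>\<^bsub>A\<^esub> g \<longrightarrow> f = \<zero>\<^bsub>A\<^esub> \<or> g = \<zero>\<^bsub>A\<^esub>)"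

definition block_decomposition :: "('a, 'm) ring_scheme \<Rightarrow> 'a set \<Rightarrow> bool"
  where "block_decomposition A E \<longleftrightarrow>
    finite E \<and> (\<forall>e\<in>E. primitive_central_idempotent A e) \<and>
    (\<forall>e\<in>E. \<forall>f\<in>E. e \<noteq> f \<longrightarrow> e \<otimes>\<^bsub>A\<^esub> f = \<zero>\<^bsub>A\<^esub>) \<and>
    (\<Oplus>\<^bsub>A\<^esub>e\<in>E. e) = \<one>\<^bsub>A\<^esub>"

text \<open>\<open>PIdl\<^bsub>A\<^esub> e\<close> is \<open>{x \<otimes>\<^bsub>A\<^esub> e | x. x \<in> carrier A}\<close>, i.e. \<open>Ae\<close>.\<close>

definition blocks :: "('a, 'm) ring_scheme \<Rightarrow> 'a set set"
  where "blocks A = {PIdl\<^bsub>A\<^esub> e | e E. block_decomposition A E \<and> e \<in> E}"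

text \<open>
  A decomposition is unique if it exists, so \<^const>\<open>blocks\<close> never mixes several of them.
\<close>

lemma block_decomposition_unique:
  assumes "ring A" "block_decomposition A E"
  shows "E = {e. primitive_central_idempotent A e}"
proof -
  interpret A: ring A by fact
  have split: "e \<otimes>\<^bsub>A\<^esub> f = \<zero>\<^bsub>A\<^esub> \<or> e \<otimes>\<^bsub>A\<^esub> f = e"
    if e: "primitive_central_idempotent A e" and f: "central_idempotent A f" for e f
  proof -
    have ec: "e \<in> carrier A" "e \<otimes>\<^bsub>A\<^esub> e = e" "\<And>x. x \<in> carrier A \<Longrightarrow> e \<otimes>\<^bsub>A\<^esub> x = x \<otimes>\<^bsub>A\<^esub> e"
      using e unfolding primitive_central_idempotent_def central_idempotent_def by blast+
    have fc: "f \<in> carrier A" "f \<otimes>\<^bsub>A\<^esub> f = f" "\<And>x. x \<in> carrier A \<Longrightarrow> f \<otimes>\<^bsub>A\<^esub> x = x \<otimes>\<^bsub>A\<^esub> f"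
      using f unfolding central_idempotent_def by blast+
    have prod: "central_idempotent A (e \<otimes>\<^bsub>A\<^esub> g)" if g: "central_idempotent A g" for g
    proof -
      have gc: "g \<in> carrier A" "g \<otimes>\<^bsub>A\<^esub> g = g" "\<And>x. x \<in> carrier A \<Longrightarrow> g \<otimes>\<^bsub>A\<^esub> x = x \<otimes>\<^bsub>A\<^esub> g"
        using g unfolding central_idempotent_def by blast+
      have "e \<otimes>\<^bsub>A\<^esub> g \<otimes>\<^bsub>A\<^esub> (e \<otimes>\<^bsub>A\<^esub> g) = e \<otimes>\<^bsub>A\<^esub> g"
        using ec(1,2) gc(1,2) ec(3)[of g] by (metis A.m_assoc A.m_closed)
      moreover have "e \<otimes>\<^bsub>A\<^esub> g \<otimes>\<^bsub>A\<^esub> x = x \<otimes>\<^bsub>A\<^esub> (e \<otimes>\<^bsub>A\<^esub> g)" if "x \<in> carrier A" for x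
        using ec(1) gc(1) ec(3)[OF that] gc(3)[OF that] that by (metis A.m_assoc)
      ultimately show ?thesis
        using ec(1) gc(1) unfolding central_idempotent_def by blast
    qed
    let ?g = "\<one>\<^bsub>A\<^esub> \<ominus>\<^bsub>A\<^esub> f"
    have fg: "f \<otimes>\<^bsub>A\<^esub> ?g = \<zero>\<^bsub>A\<^esub>" "f \<oplus>\<^bsub>A\<^esub> ?g = \<one>\<^bsub>A\<^esub>"
      using fc(1,2) A.a_lcomm[of f "\<one>\<^bsub>A\<^esub>" "\<ominus>\<^bsub>A\<^esub> f"]
      by (simp_all add: A.minus_eq A.r_distr A.r_minus A.r_neg)
    have gf: "?g \<otimes>\<^bsub>A\<^esub> ?g = ?g"
      using fc(1,2) by (simp add: A.minus_eq A.r_distr A.l_distr A.r_minus A.l_minus A.r_neg)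
    have "?g \<otimes>\<^bsub>A\<^esub> x = x \<otimes>\<^bsub>A\<^esub> ?g" if "x \<in> carrier A" for x
      using fc(1) fc(3)[OF that] that
      by (simp add: A.minus_eq A.r_distr A.l_distr A.r_minus A.l_minus)
    then have g: "central_idempotent A ?g"
      using gf fc(1) unfolding central_idempotent_def by blast
    have sp: "e = e \<otimes>\<^bsub>A\<^esub> f \<oplus>\<^bsub>A\<^esub> e \<otimes>\<^bsub>A\<^esub> ?g"
      using ec(1) fc(1) fg(2) by (simp flip: A.r_distr)
    have "e \<otimes>\<^bsub>A\<^esub> f \<otimes>\<^bsub>A\<^esub> (e \<otimes>\<^bsub>A\<^esub> ?g) = \<zero>\<^bsub>A\<^esub>"
    proof -
      have "e \<otimes>\<^bsub>A\<^esub> f \<otimes>\<^bsub>A\<^esub> (e \<otimes>\<^bsub>A\<^esub> ?g) = f \<otimes>\<^bsub>A\<^esub> e \<otimes>\<^bsub>A\<^esub> (e \<otimes>\<^bsub>A\<^esub> ?g)"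
        by (simp only: ec(3)[OF fc(1)])
      also have "\<dots> = f \<otimes>\<^bsub>A\<^esub> (e \<otimes>\<^bsub>A\<^esub> e \<otimes>\<^bsub>A\<^esub> ?g)"
        using ec(1) fc(1) by (simp add: A.m_assoc)
      also have "\<dots> = f \<otimes>\<^bsub>A\<^esub> (?g \<otimes>\<^bsub>A\<^esub> e)"
        using fc(1) ec(2) ec(3)[of ?g] by simp
      also have "\<dots> = f \<otimes>\<^bsub>A\<^esub> ?g \<otimes>\<^bsub>A\<^esub> e"
        using ec(1) fc(1) by (simp add: A.m_assoc)
      finally show ?thesis using fg(1) ec(1) by simp
    qed
    with sp have "e \<otimes>\<^bsub>A\<^esub> f = \<zero>\<^bsub>A\<^esub> \<or> e \<otimes>\<^bsub>A\<^esub> ?g = \<zero>\<^bsub>A\<^esub>"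
      using e prod[OF f] prod[OF g] unfolding primitive_central_idempotent_def by blast
    then show ?thesis
      using sp ec(1) fc(1) by (metis A.m_closed A.r_zero)
  qed
  have prim: "primitive_central_idempotent A e" if "e \<in> E" for e
    using assms(2) that unfolding block_decomposition_def by blast
  have sub: "E \<subseteq> carrier A"
    using prim unfolding primitive_central_idempotent_def central_idempotent_def by blast
  have "e \<in> E" if e: "primitive_central_idempotent A e" for e
  proof -
    have ec: "e \<in> carrier A" "e \<noteq> \<zero>\<^bsub>A\<^esub>" "\<And>x. x \<in> carrier A \<Longrightarrow> e \<otimes>\<^bsub>A\<^esub> x = x \<otimes>\<^bsub>A\<^esub> e"
      "central_idempotent A e"
      using e unfolding primitive_central_idempotent_def central_idempotent_def by blast+
    have "e = e \<otimes>\<^bsub>A\<^esub> (\<Oplus>\<^bsub>A\<^esub>f\<in>E. f)"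
      using assms(2) ec(1) by (simp add: block_decomposition_def)
    also have "\<dots> = (\<Oplus>\<^bsub>A\<^esub>f\<in>E. e \<otimes>\<^bsub>A\<^esub> f)"
      using assms(2) ec(1) sub by (intro A.finsum_rdistr) (auto simp: block_decomposition_def)
    finally have eq: "e = (\<Oplus>\<^bsub>A\<^esub>f\<in>E. e \<otimes>\<^bsub>A\<^esub> f)" .
    have "\<exists>f\<in>E. e \<otimes>\<^bsub>A\<^esub> f \<noteq> \<zero>\<^bsub>A\<^esub>"
    proof (rule ccontr)
      assume "\<not> ?thesis"
      then have "(\<Oplus>\<^bsub>A\<^esub>f\<in>E. e \<otimes>\<^bsub>A\<^esub> f) = (\<Oplus>\<^bsub>A\<^esub>f\<in>E. \<zero>\<^bsub>A\<^esub>)"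
        by (intro A.finsum_cong') auto
      then show False using eq ec(2) by (simp add: A.finsum_zero)
    qed
    then obtain f where f: "f \<in> E" "e \<otimes>\<^bsub>A\<^esub> f \<noteq> \<zero>\<^bsub>A\<^esub>" by blast
    have fi: "central_idempotent A f" "f \<in> carrier A"
      using prim[OF f(1)] unfolding primitive_central_idempotent_def central_idempotent_def by blast+
    have "e \<otimes>\<^bsub>A\<^esub> f = e" using split[OF e fi(1)] f(2) by blast
    moreover have "f \<otimes>\<^bsub>A\<^esub> e = f"
      using split[OF prim[OF f(1)] ec(4)] f(2) ec(3)[OF fi(2)] by metis
    ultimately show ?thesis using ec(3)[OF fi(2)] f(1) by metis
  qed
  with prim show ?thesis by blast
qed

end

theory Submission
  imports Defs
begin

text \<open>
  The group algebra has exactly one block because its only central idempotents are \<open>0\<close> and \<open>1\<close>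
  (\<open>ring.blocks_trivial_idempotents\<close>). Let \<open>V\<close> be the Klein four-group in \<open>A\<^sub>4\<close>. No nontrivial
  element of \<open>V\<close> commutes with an element \<open>x\<close> outside \<open>V\<close>, so \<open>u \<mapsto> x\<^sup>-\<^sup>1u\<^sup>-\<^sup>1xu\<close> is injective on
  \<open>V\<close>, hence onto \<open>V\<close>, and the whole coset \<open>xV\<close> lies in the conjugacy class of \<open>x\<close>
  (\<open>normal.coset_conjugate\<close>).

  A central element \<open>e\<close> is a class function, so it is constant on every coset of \<open>V\<close> other than \<open>V\<close>.
  If \<open>e = e\<^sup>2\<close>, then \<open>e(g) = \<Sum>\<^sub>y e(y) e(y\<^sup>-\<^sup>1g)\<close>, and for every \<open>g \<noteq> 1\<close> the terms of this sum can be
  matched in pairs of equal value, which cancel in characteristic \<open>2\<close>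
  (\<open>ring.finsum_involution_eq_zero\<close>). So \<open>e\<close> is a scalar multiple of \<open>1\<close>, and a scalar that is
  idempotent in a domain is \<open>0\<close> or \<open>1\<close>. This argument, \<open>central_idempotent_group_algebra_char2\<close>,
  applies to any finite group with a nontrivial subgroup \<open>V\<close> of exponent \<open>2\<close> such that \<open>xV\<close> lies in
  the conjugacy class of \<open>x\<close> for all \<open>x\<close> outside \<open>V\<close>.
\<close>

section \<open>Cancellation in characteristic two\<close>

lemma (in ring) finsum_involution_eq_zero:
  assumes char2: "\<one> \<oplus> \<one> = \<zero>" and "finite S" "f \<in> S \<rightarrow> carrier R"
    and "\<And>y. y \<in> S \<Longrightarrow> t y \<in> S" "\<And>y. y \<in> S \<Longrightarrow> t (t y) = y"
    and "\<And>y. y \<in> S \<Longrightarrow> t y \<noteq> y" "\<And>y. y \<in> S \<Longrightarrow> f (t y) = f y"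
  shows "(\<Oplus>y\<in>S. f y) = \<zero>"
  using assms(2-)
proof (induction S rule: finite_psubset_induct)
  case (psubset S)
  show ?case
  proof (cases "S = {}")
    case False
    then obtain a where a: "a \<in> S" by blast
    let ?S = "S - {a, t a}"
    have clo: "t y \<in> ?S" if "y \<in> ?S" for y
      using that a psubset.prems(2,3) by (metis Diff_iff insert_iff empty_iff)
    have "(\<Oplus>y\<in>?S. f y) = \<zero>"
      by (rule psubset.IH) (use a clo psubset.prems in auto)
    moreover have "S = insert a (insert (t a) ?S)"
      using a psubset.prems(2) by auto
    moreover have "(\<Oplus>y\<in>insert a (insert (t a) ?S). f y) = f a \<oplus> (f (t a) \<oplus> (\<Oplus>y\<in>?S. f y))"
    proof -
      have "f a \<in> carrier R" "f (t a) \<in> carrier R" "f \<in> ?S \<rightarrow> carrier R"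
        using psubset.prems(1,2) a by auto
      then show ?thesis
        using psubset.hyps psubset.prems(4)[OF a] by (simp add: finsum_insert)
    qed
    moreover have "f a \<oplus> f a = \<zero>"
      using char2 psubset.prems(1) a
      by (metis PiE l_distr l_null l_one one_closed)
    ultimately show ?thesis
      using a psubset.prems by (metis PiE r_zero)
  qed simp
qed

section \<open>Central elements of a group algebra\<close>

lemma group_algebra_mult_apply:
  "x \<in> carrier G \<Longrightarrow> (a \<otimes>\<^bsub>group_algebra k G\<^esub> b) x =
     (\<Oplus>\<^bsub>k\<^esub>y\<in>carrier G. a y \<otimes>\<^bsub>k\<^esub> b (inv\<^bsub>G\<^esub> y \<otimes>\<^bsub>G\<^esub> x))"
  by (simp add: group_algebra_def)

text \<open>
  Centrality is tested on the basis element \<open>g\<^sup>-\<^sup>1\<close> alone: the coefficients at \<open>h\<close> of \<open>g\<^sup>-\<^sup>1e\<close> and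
  \<open>eg\<^sup>-\<^sup>1\<close> are \<open>e(gh)\<close> and \<open>e(hg)\<close>. Equality of these two says that \<open>e\<close> is a class function.
\<close>

lemma group_algebra_central_comm:
  assumes "cring k" "group G" "finite (carrier G)"
    and e: "e \<in> carrier (group_algebra k G)"
    and cen: "\<And>x. x \<in> carrier (group_algebra k G) \<Longrightarrow>
      e \<otimes>\<^bsub>group_algebra k G\<^esub> x = x \<otimes>\<^bsub>group_algebra k G\<^esub> e"
    and g: "g \<in> carrier G" and h: "h \<in> carrier G"
  shows "e (g \<otimes>\<^bsub>G\<^esub> h) = e (h \<otimes>\<^bsub>G\<^esub> g)"
proof -
  interpret k: cring k by fact
  interpret G: group G by fact
  let ?A = "group_algebra k G"
  define d where "d = (\<lambda>x\<in>carrier G. if x = inv\<^bsub>G\<^esub> g then \<one>\<^bsub>k\<^esub> else \<zero>\<^bsub>k\<^esub>)"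
  have dA: "d \<in> carrier ?A" by (auto simp: d_def group_algebra_def)
  have val: "e x \<in> carrier k" if "x \<in> carrier G" for x
    using e that by (auto simp: group_algebra_def)
  have "(d \<otimes>\<^bsub>?A\<^esub> e) h =
      (\<Oplus>\<^bsub>k\<^esub>y\<in>carrier G. if inv\<^bsub>G\<^esub> g = y then e (inv\<^bsub>G\<^esub> y \<otimes>\<^bsub>G\<^esub> h) else \<zero>\<^bsub>k\<^esub>)"
    unfolding group_algebra_mult_apply[OF h] using h val
    by (intro k.finsum_cong') (auto simp: d_def)
  also have "\<dots> = e (g \<otimes>\<^bsub>G\<^esub> h)"
    using k.finsum_singleton[of "inv\<^bsub>G\<^esub> g" "carrier G" "\<lambda>y. e (inv\<^bsub>G\<^esub> y \<otimes>\<^bsub>G\<^esub> h)"] assms(3) g h val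
    by auto
  finally have 1: "(d \<otimes>\<^bsub>?A\<^esub> e) h = e (g \<otimes>\<^bsub>G\<^esub> h)" .
  have *: "inv\<^bsub>G\<^esub> y \<otimes>\<^bsub>G\<^esub> h = inv\<^bsub>G\<^esub> g \<longleftrightarrow> h \<otimes>\<^bsub>G\<^esub> g = y" if "y \<in> carrier G" for y
    using that g h
    by (metis G.inv_solve_left G.inv_solve_right G.inv_closed G.inv_inv)
  have "(e \<otimes>\<^bsub>?A\<^esub> d) h = (\<Oplus>\<^bsub>k\<^esub>y\<in>carrier G. if h \<otimes>\<^bsub>G\<^esub> g = y then e y else \<zero>\<^bsub>k\<^esub>)"
    unfolding group_algebra_mult_apply[OF h] using h val
    by (intro k.finsum_cong') (auto simp: d_def *)
  also have "\<dots> = e (h \<otimes>\<^bsub>G\<^esub> g)"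
    using k.finsum_singleton[of "h \<otimes>\<^bsub>G\<^esub> g" "carrier G" e] assms(3) g h val by auto
  finally show ?thesis using 1 cen[OF dA] by simp
qed

section \<open>Central idempotents in characteristic two\<close>

text \<open>
  The conjugacy hypothesis makes a class function blind to multiplication by \<open>V\<close> outside \<open>V\<close>, on
  either side. This leaves enough freedom to pair the terms of \<open>\<Sum>\<^sub>y e(y) e(y\<^sup>-\<^sup>1g)\<close> for \<open>g \<noteq> 1\<close>, but
  the pairing depends on whether \<open>g\<close> lies in \<open>V\<close>.
\<close>

lemma central_idempotent_group_algebra_char2:
  assumes "domain k" and char2: "\<one>\<^bsub>k\<^esub> \<oplus>\<^bsub>k\<^esub> \<one>\<^bsub>k\<^esub> = \<zero>\<^bsub>k\<^esub>"
    and "group G" and fin: "finite (carrier G)"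
    and "subgroup V G" and "V \<noteq> {\<one>\<^bsub>G\<^esub>}"
    and sq: "\<And>v. v \<in> V \<Longrightarrow> v \<otimes>\<^bsub>G\<^esub> v = \<one>\<^bsub>G\<^esub>"
    and conj: "\<And>x v. x \<in> carrier G - V \<Longrightarrow> v \<in> V \<Longrightarrow>
      \<exists>u\<in>carrier G. x \<otimes>\<^bsub>G\<^esub> v = inv\<^bsub>G\<^esub> u \<otimes>\<^bsub>G\<^esub> (x \<otimes>\<^bsub>G\<^esub> u)"
    and "central_idempotent (group_algebra k G) e"
  shows "e = \<zero>\<^bsub>group_algebra k G\<^esub> \<or> e = \<one>\<^bsub>group_algebra k G\<^esub>"
proof -
  interpret k: domain k by fact
  interpret G: group G by fact
  interpret V: subgroup V G by fact
  let ?A = "group_algebra k G"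
  have eA: "e \<in> carrier ?A" and idem: "e \<otimes>\<^bsub>?A\<^esub> e = e"
    and cen: "\<And>x. x \<in> carrier ?A \<Longrightarrow> e \<otimes>\<^bsub>?A\<^esub> x = x \<otimes>\<^bsub>?A\<^esub> e"
    using assms(9) unfolding central_idempotent_def by blast+
  have val [simp]: "e x \<in> carrier k" if "x \<in> carrier G" for x
    using eA that by (auto simp: group_algebra_def)
  have comm: "e (g \<otimes>\<^bsub>G\<^esub> h) = e (h \<otimes>\<^bsub>G\<^esub> g)" if "g \<in> carrier G" "h \<in> carrier G" for g h
    using group_algebra_central_comm[OF k.is_cring assms(3) fin eA cen that] .
  have VG [simp]: "v \<in> carrier G" if "v \<in> V" for v using that by (rule V.mem_carrier)
  have cosetR: "e (x \<otimes>\<^bsub>G\<^esub> v) = e x" if x: "x \<in> carrier G" "x \<notin> V" and v: "v \<in> V" for x v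
  proof -
    obtain u where u: "u \<in> carrier G" "x \<otimes>\<^bsub>G\<^esub> v = inv\<^bsub>G\<^esub> u \<otimes>\<^bsub>G\<^esub> (x \<otimes>\<^bsub>G\<^esub> u)"
      using conj x v by blast
    then show ?thesis
      using x comm[of "inv\<^bsub>G\<^esub> u" "x \<otimes>\<^bsub>G\<^esub> u"] by (simp add: G.m_assoc)
  qed
  have cosetL: "e (v \<otimes>\<^bsub>G\<^esub> x) = e x" if "x \<in> carrier G" "x \<notin> V" and "v \<in> V" for x v
    using that cosetR comm[of v x] by simp
  have invV: "inv\<^bsub>G\<^esub> v = v" if "v \<in> V" for v
    using sq[OF that] that by (simp add: G.inv_equality)
  have memV: "x \<otimes>\<^bsub>G\<^esub> v \<in> V \<longleftrightarrow> x \<in> V" if "x \<in> carrier G" "v \<in> V" for x v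
    using that by (metis G.inv_closed G.inv_solve_right VG V.m_closed V.m_inv_closed)
  have sqr: "e g = (\<Oplus>\<^bsub>k\<^esub>y\<in>carrier G. e y \<otimes>\<^bsub>k\<^esub> e (inv\<^bsub>G\<^esub> y \<otimes>\<^bsub>G\<^esub> g))" if "g \<in> carrier G" for g
    using idem group_algebra_mult_apply[OF that, of k e e] by simp
  have cancel [simp]: "x \<otimes>\<^bsub>G\<^esub> v \<otimes>\<^bsub>G\<^esub> v = x" if "x \<in> carrier G" "v \<in> V" for x v
    using that by (simp add: G.m_assoc sq)
  have cancel_r [simp]: "inv\<^bsub>G\<^esub> x \<otimes>\<^bsub>G\<^esub> (x \<otimes>\<^bsub>G\<^esub> y) = y" "x \<otimes>\<^bsub>G\<^esub> (inv\<^bsub>G\<^esub> x \<otimes>\<^bsub>G\<^esub> y) = y"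
    if "x \<in> carrier G" "y \<in> carrier G" for x y
    using that by (simp_all flip: G.m_assoc)
  obtain w where w: "w \<in> V" "w \<noteq> \<one>\<^bsub>G\<^esub>"
    using assms(6) V.one_closed by blast
  have supp_out: "e g = \<zero>\<^bsub>k\<^esub>" if g: "g \<in> carrier G" "g \<notin> V" for g
  proof -
    (* For y in V or in gV exactly one factor has its argument in V; swapping the two cosets swaps
       the factors. For any other y both arguments lie outside V, where translation by the fixed
       involution w does not change e. *)
    define t where "t y = (if y \<in> V then g \<otimes>\<^bsub>G\<^esub> y else if inv\<^bsub>G\<^esub> g \<otimes>\<^bsub>G\<^esub> y \<in> V
        then inv\<^bsub>G\<^esub> g \<otimes>\<^bsub>G\<^esub> y else y \<otimes>\<^bsub>G\<^esub> w)" for y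
    have "(\<Oplus>\<^bsub>k\<^esub>y\<in>carrier G. e y \<otimes>\<^bsub>k\<^esub> e (inv\<^bsub>G\<^esub> y \<otimes>\<^bsub>G\<^esub> g)) = \<zero>\<^bsub>k\<^esub>"
    proof (rule k.finsum_involution_eq_zero[where t = t, OF char2 fin])
      fix y assume y: "y \<in> carrier G"
      consider (V) "y \<in> V" | (gV) v where "v \<in> V" "y = g \<otimes>\<^bsub>G\<^esub> v"
        | (out) "y \<notin> V" "inv\<^bsub>G\<^esub> g \<otimes>\<^bsub>G\<^esub> y \<notin> V"
        using cancel_r(2)[OF g(1) y] by metis
      note cases = this
      show "t y \<in> carrier G" using y g w by (simp add: t_def)
      show "t (t y) = y" using cases
        by cases (use y g w in \<open>simp_all add: t_def memV flip: G.m_assoc\<close>)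
      show "t y \<noteq> y" using cases
      proof cases
        case V then show ?thesis using g memV[of g y] by (auto simp: t_def)
      next
        case gV then show ?thesis using g memV[of g v] by (auto simp: t_def)
      next
        case out then show ?thesis using y w by (simp add: t_def)
      qed
      have half: "e (g \<otimes>\<^bsub>G\<^esub> v) \<otimes>\<^bsub>k\<^esub> e (inv\<^bsub>G\<^esub> (g \<otimes>\<^bsub>G\<^esub> v) \<otimes>\<^bsub>G\<^esub> g) = e v \<otimes>\<^bsub>k\<^esub> e (inv\<^bsub>G\<^esub> v \<otimes>\<^bsub>G\<^esub> g)"
        if v: "v \<in> V" for v
      proof -
        have "inv\<^bsub>G\<^esub> (g \<otimes>\<^bsub>G\<^esub> v) \<otimes>\<^bsub>G\<^esub> g = v"
          using v g by (simp add: G.inv_mult_group G.m_assoc invV)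
        then show ?thesis
          using v g by (simp add: invV cosetR cosetL k.m_comm)
      qed
      show "e (t y) \<otimes>\<^bsub>k\<^esub> e (inv\<^bsub>G\<^esub> (t y) \<otimes>\<^bsub>G\<^esub> g) = e y \<otimes>\<^bsub>k\<^esub> e (inv\<^bsub>G\<^esub> y \<otimes>\<^bsub>G\<^esub> g)"
        using cases
      proof cases
        case V then show ?thesis using half by (simp add: t_def)
      next
        case gV then show ?thesis using half[of v] g memV[of g v] by (simp add: t_def)
      next
        case out
        have "inv\<^bsub>G\<^esub> (inv\<^bsub>G\<^esub> g \<otimes>\<^bsub>G\<^esub> y) = inv\<^bsub>G\<^esub> y \<otimes>\<^bsub>G\<^esub> g"
          using y g by (simp add: G.inv_mult_group)
        then have "inv\<^bsub>G\<^esub> y \<otimes>\<^bsub>G\<^esub> g \<notin> V"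
          using out(2) y g by (metis G.inv_inv G.inv_closed G.m_closed V.m_inv_closed)
        then have "e (w \<otimes>\<^bsub>G\<^esub> (inv\<^bsub>G\<^esub> y \<otimes>\<^bsub>G\<^esub> g)) = e (inv\<^bsub>G\<^esub> y \<otimes>\<^bsub>G\<^esub> g)"
          using y g w by (intro cosetL) auto
        then show ?thesis
          using out y g w by (simp add: t_def cosetR G.inv_mult_group invV G.m_assoc)
      qed
    qed (use g in auto)
    then show ?thesis using sqr[OF g(1)] by simp
  qed
  have supp_in: "e g = \<zero>\<^bsub>k\<^esub>" if g: "g \<in> V" "g \<noteq> \<one>\<^bsub>G\<^esub>" for g
  proof -
    (* Translating y by g swaps the two factors if y is in V, where y is its own inverse; otherwise
       it fixes both, since both arguments lie outside V. *)
    have "(\<Oplus>\<^bsub>k\<^esub>y\<in>carrier G. e y \<otimes>\<^bsub>k\<^esub> e (inv\<^bsub>G\<^esub> y \<otimes>\<^bsub>G\<^esub> g)) = \<zero>\<^bsub>k\<^esub>"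
    proof (rule k.finsum_involution_eq_zero[where t = "\<lambda>y. y \<otimes>\<^bsub>G\<^esub> g", OF char2 fin])
      fix y assume y: "y \<in> carrier G"
      have "e (inv\<^bsub>G\<^esub> (y \<otimes>\<^bsub>G\<^esub> g) \<otimes>\<^bsub>G\<^esub> g) = e (inv\<^bsub>G\<^esub> y)"
        using y g comm[of g "inv\<^bsub>G\<^esub> y \<otimes>\<^bsub>G\<^esub> g"]
        by (simp add: G.inv_mult_group invV G.m_assoc sq)
      moreover have "inv\<^bsub>G\<^esub> y \<in> V \<longleftrightarrow> y \<in> V"
        using y by (metis G.inv_inv V.m_inv_closed)
      ultimately show "e (y \<otimes>\<^bsub>G\<^esub> g) \<otimes>\<^bsub>k\<^esub> e (inv\<^bsub>G\<^esub> (y \<otimes>\<^bsub>G\<^esub> g) \<otimes>\<^bsub>G\<^esub> g)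
          = e y \<otimes>\<^bsub>k\<^esub> e (inv\<^bsub>G\<^esub> y \<otimes>\<^bsub>G\<^esub> g)"
        using y g by (cases "y \<in> V") (simp_all add: invV cosetR k.m_comm)
    qed (use g in auto)
    then show ?thesis using sqr[of g] g by simp
  qed
  have supp: "e g = \<zero>\<^bsub>k\<^esub>" if "g \<in> carrier G" "g \<noteq> \<one>\<^bsub>G\<^esub>" for g
    using that supp_in supp_out by blast
  have "e \<one>\<^bsub>G\<^esub> = (\<Oplus>\<^bsub>k\<^esub>y\<in>carrier G. if \<one>\<^bsub>G\<^esub> = y then e y \<otimes>\<^bsub>k\<^esub> e y else \<zero>\<^bsub>k\<^esub>)"
    unfolding sqr[OF G.one_closed] by (intro k.finsum_cong') (auto simp: supp)
  also have "\<dots> = e \<one>\<^bsub>G\<^esub> \<otimes>\<^bsub>k\<^esub> e \<one>\<^bsub>G\<^esub>"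
    using k.finsum_singleton[of "\<one>\<^bsub>G\<^esub>" "carrier G" "\<lambda>y. e y \<otimes>\<^bsub>k\<^esub> e y"] fin by auto
  finally have "e \<one>\<^bsub>G\<^esub> = \<zero>\<^bsub>k\<^esub> \<or> e \<one>\<^bsub>G\<^esub> = \<one>\<^bsub>k\<^esub>"
    by (metis G.one_closed k.m_lcancel k.one_closed k.r_one val)
  moreover have "e = \<zero>\<^bsub>?A\<^esub>" if "e \<one>\<^bsub>G\<^esub> = \<zero>\<^bsub>k\<^esub>"
    using eA supp that
    by (intro extensionalityI[of _ "carrier G"]) (auto simp: group_algebra_def PiE_def)
  moreover have "e = \<one>\<^bsub>?A\<^esub>" if "e \<one>\<^bsub>G\<^esub> = \<one>\<^bsub>k\<^esub>"
    using eA supp that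
    by (intro extensionalityI[of _ "carrier G"]) (auto simp: group_algebra_def PiE_def)
  ultimately show ?thesis by blast
qed

text \<open>
  If \<open>x\<close> acts on the finite normal subgroup \<open>H\<close> without nontrivial fixed points, then the map
  \<open>u \<mapsto> x\<^sup>-\<^sup>1u\<^sup>-\<^sup>1xu\<close> of \<open>H\<close> into itself is injective, so every \<open>v\<close> in \<open>H\<close> is such a commutator.
\<close>

lemma (in normal) coset_conjugate:
  assumes "finite H" and x: "x \<in> carrier G" and v: "v \<in> H"
    and free: "\<And>u. u \<in> H \<Longrightarrow> u \<otimes> x = x \<otimes> u \<Longrightarrow> u = \<one>"
  shows "\<exists>u\<in>H. x \<otimes> v = inv u \<otimes> (x \<otimes> u)"
proof -
  let ?f = "\<lambda>u. inv x \<otimes> (inv u \<otimes> (x \<otimes> u))"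
  have "inj_on ?f H"
  proof (rule inj_onI)
    fix a b assume a: "a \<in> H" and b: "b \<in> H" and eq: "?f a = ?f b"
    have "inv a \<otimes> (x \<otimes> a) = inv b \<otimes> (x \<otimes> b)"
      using eq a b x by simp
    have "(b \<otimes> inv a) \<otimes> x = b \<otimes> (inv a \<otimes> (x \<otimes> a)) \<otimes> inv a"
      using a b x by (simp add: m_assoc)
    also have "\<dots> = b \<otimes> (inv b \<otimes> (x \<otimes> b)) \<otimes> inv a"
      by (simp only: \<open>inv a \<otimes> (x \<otimes> a) = inv b \<otimes> (x \<otimes> b)\<close>)
    also have "\<dots> = x \<otimes> (b \<otimes> inv a)"
      using a b x by (simp flip: m_assoc)
    finally have "b \<otimes> inv a = \<one>" using free a b by simp
    then show "a = b" using inv_equality[of b "inv a"] a b by simp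
  qed
  moreover have "?f ` H \<subseteq> H"
  proof
    fix z assume "z \<in> ?f ` H"
    then obtain u where u: "u \<in> H" "z = ?f u" by blast
    have "z = (inv x \<otimes> inv u \<otimes> x) \<otimes> u" using u x by (simp add: m_assoc)
    then show "z \<in> H" using u x inv_op_closed1 by auto
  qed
  ultimately have "?f ` H = H" using assms(1) by (simp add: endo_inj_surj)
  then obtain u where u: "u \<in> H" "v = ?f u" using v by blast
  then have "x \<otimes> v = inv u \<otimes> (x \<otimes> u)"
    using x by (simp flip: m_assoc)
  then show ?thesis using u by blast
qed

section \<open>The alternating group of degree four\<close>

text \<open>
  Every permutation of \<open>{1..4}\<close> factors as \<open>(1 b)(2 c)(3 d)\<close> with \<open>c \<ge> 2\<close>, \<open>d \<ge> 3\<close>, where a factor may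
  be trivial; it is even iff an even number of the factors is nontrivial. Enumerating the triples
  \<open>(b, c, d)\<close> therefore settles parity without computing any sign.
\<close>

lemma alt_group_4_values:
  assumes "p \<in> carrier (alt_group 4)"
  shows "(p 1, p 2, p 3, p 4) \<in> {(1,2,3,4), (2,1,4,3), (3,4,1,2), (4,3,2,1),
    (1,3,4,2), (1,4,2,3), (2,3,1,4), (2,4,3,1), (3,1,2,4), (3,2,4,1), (4,1,3,2), (4,2,1,3)}"
proof -
  have "{1..4} = insert 1 (insert 2 (insert 3 {4::nat}))" by auto
  then have p: "p \<in> {p. p permutes insert 1 (insert 2 (insert 3 {4::nat}))}" and "evenperm p"
    using assms by (auto simp: alt_group_carrier)
  from p have "\<exists>b\<in>{1,2,3,4}. \<exists>c\<in>{2,3,4}. \<exists>d\<in>{3,4}.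
      p = transpose 1 b \<circ> (transpose 2 c \<circ> transpose 3 d)"
    unfolding permutes_insert permutes_sing by fastforce
  then obtain b c d where "p = transpose 1 b \<circ> (transpose 2 c \<circ> transpose 3 d)"
    "b \<in> {1,2,3,4}" "c \<in> {2,3,4}" "d \<in> {3,4}"
    by blast
  with \<open>evenperm p\<close> show ?thesis
    by (elim insertE emptyE)
       (simp_all add: evenperm_comp evenperm_swap permutation_swap_id permutation_compose transpose_def)
qed

lemma alt_group_4_eqI:
  assumes "p \<in> carrier (alt_group 4)" "q \<in> carrier (alt_group 4)"
    and "p 1 = q 1" "p 2 = q 2" "p 3 = q 3" "p 4 = q 4"
  shows "p = q"
proof
  fix i :: nat
  consider "i \<in> {1, 2, 3, 4}" | "i \<notin> {1..4}" by fastforce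
  then show "p i = q i"
    using assms by cases (auto simp: alt_group_carrier permutes_not_in)
qed

text \<open>
  Described by \<open>p\<^sup>2 = 1\<close>, the four-group is visibly closed under conjugation; closure under products
  is then a check on values.
\<close>

definition klein_four :: "(nat \<Rightarrow> nat) set"
  where "klein_four = {p \<in> carrier (alt_group 4). p \<circ> p = id}"

lemma klein_four_values:
  assumes "p \<in> klein_four"
  shows "(p 1, p 2, p 3, p 4) \<in> {(1,2,3,4), (2,1,4,3), (3,4,1,2), (4,3,2,1)}"
proof -
  have "p (p i) = i" for i using assms unfolding klein_four_def by (auto simp: fun_eq_iff)
  from this[of 1] this[of 2] this[of 3] this[of 4] show ?thesis
    using alt_group_4_values[of p] assms unfolding klein_four_def by auto
qed

lemma klein_four_normal: "klein_four \<lhd> alt_group 4"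
proof -
  interpret A: group "alt_group 4" by (rule alt_group_is_group)
  let ?G = "alt_group 4"
  have mem: "p \<in> klein_four \<longleftrightarrow> p \<in> carrier ?G \<and> p \<otimes>\<^bsub>?G\<^esub> p = \<one>\<^bsub>?G\<^esub>" for p
    by (simp add: klein_four_def alt_group_mult alt_group_one)
  have cl: "p \<otimes>\<^bsub>?G\<^esub> q \<in> klein_four" if p: "p \<in> klein_four" and q: "q \<in> klein_four" for p q
  proof -
    have pq: "p \<circ> q \<in> carrier ?G"
      using A.m_closed[of p q] p q by (simp add: mem alt_group_mult)
    then have "(p \<circ> q) \<circ> (p \<circ> q) \<in> carrier ?G"
      using A.m_closed[of "p \<circ> q" "p \<circ> q"] by (simp add: alt_group_mult)
    moreover have "id \<in> carrier ?G" using A.one_closed by (simp add: alt_group_one)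
    ultimately have "(p \<circ> q) \<circ> (p \<circ> q) = id"
      using klein_four_values[OF p] klein_four_values[OF q] by (intro alt_group_4_eqI) auto
    then show ?thesis using pq by (simp add: klein_four_def alt_group_mult)
  qed
  have "subgroup klein_four ?G"
  proof (rule A.subgroupI)
    show "inv\<^bsub>?G\<^esub> p \<in> klein_four" if "p \<in> klein_four" for p
      using that A.inv_equality[of p p] by (simp add: mem)
    have "\<one>\<^bsub>?G\<^esub> \<in> klein_four" by (simp add: mem)
    then show "klein_four \<noteq> {}" by blast
  qed (use cl in \<open>auto simp: mem\<close>)
  moreover have "x \<otimes>\<^bsub>?G\<^esub> h \<otimes>\<^bsub>?G\<^esub> inv\<^bsub>?G\<^esub> x \<in> klein_four"
    if x: "x \<in> carrier ?G" and h: "h \<in> klein_four" for x h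
  proof -
    have "inv\<^bsub>?G\<^esub> x \<otimes>\<^bsub>?G\<^esub> (x \<otimes>\<^bsub>?G\<^esub> z) = z" "h \<otimes>\<^bsub>?G\<^esub> (h \<otimes>\<^bsub>?G\<^esub> z) = z"
      if "z \<in> carrier ?G" for z
      using that x h mem by (simp_all flip: A.m_assoc)
    then show ?thesis using x h mem by (simp add: A.m_assoc)
  qed
  ultimately show ?thesis by (simp add: A.normal_inv_iff)
qed

text \<open>
  The elements outside the four-group are the 3-cycles; a 3-cycle commutes in \<open>A\<^sub>4\<close> only with its
  own powers, none of which is a double transposition.
\<close>

lemma klein_four_commute:
  assumes "x \<in> carrier (alt_group 4) - klein_four" "v \<in> klein_four" "v \<circ> x = x \<circ> v"
  shows "v = id"
proof -
  have x: "x \<in> carrier (alt_group 4)" using assms by blast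
  have id: "id \<in> carrier (alt_group 4)" by (simp add: alt_group_carrier)
  have "x \<circ> x \<in> carrier (alt_group 4)"
    using x group.is_monoid[OF alt_group_is_group, THEN monoid.m_closed, OF x x]
    by (simp add: alt_group_mult)
  then have "\<not> (x (x 1) = 1 \<and> x (x 2) = 2 \<and> x (x 3) = 3 \<and> x (x 4) = 4)"
    using assms(1) alt_group_4_eqI[OF _ id, of "x \<circ> x"] unfolding klein_four_def by auto
  moreover have "v (x i) = x (v i)" for i using assms(3) by (metis comp_apply)
  from this[of 1] this[of 2] this[of 3] this[of 4]
  have "v (x 1) = x (v 1)" "v (x 2) = x (v 2)" "v (x 3) = x (v 3)" "v (x 4) = x (v 4)" .
  ultimately have "(v 1, v 2, v 3, v 4) = (1, 2, 3, 4)"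
    using alt_group_4_values[OF x] klein_four_values[OF assms(2)] by auto
  then show ?thesis
    using assms(2) id by (intro alt_group_4_eqI) (auto simp: klein_four_def)
qed

lemma klein_four_nontrivial: "klein_four \<noteq> {id}"
proof -
  let ?p = "transpose 1 2 \<circ> transpose 3 (4::nat)"
  have "?p permutes {1..4}"
    by (intro permutes_compose permutes_swap_id) auto
  moreover have "evenperm ?p"
    by (simp add: evenperm_comp evenperm_swap permutation_swap_id)
  moreover have "?p \<circ> ?p = id" by (auto simp: fun_eq_iff transpose_def)
  ultimately have "?p \<in> klein_four" by (simp add: klein_four_def alt_group_carrier)
  moreover have "?p 1 \<noteq> id 1" by (simp add: transpose_def)
  ultimately show ?thesis by (metis singletonD)
qed

section \<open>A single block\<close>

lemma (in ring) blocks_trivial_idempotents: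
  assumes "\<one> \<noteq> \<zero>" and triv: "\<And>e. central_idempotent R e \<Longrightarrow> e = \<zero> \<or> e = \<one>"
  shows "blocks R = {carrier R}"
proof -
  have "central_idempotent R \<one>" by (simp add: central_idempotent_def)
  then have "primitive_central_idempotent R \<one>"
    using assms unfolding primitive_central_idempotent_def
    by (metis l_one one_closed)
  then have "block_decomposition R {\<one>}"
    by (simp add: block_decomposition_def)
  moreover have "E = {\<one>}" if "block_decomposition R E" for E
    using block_decomposition_unique[OF ring_axioms that]
      block_decomposition_unique[OF ring_axioms calculation] by simp
  moreover have "PIdl \<one> = carrier R"
    unfolding cgenideal_def by force
  ultimately show ?thesis unfolding blocks_def by (auto intro!: exI[of _ "{\<one>}"])
qed

theorem mainTheorem6:
  fixes k :: "('a, 'm) ring_scheme"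
  assumes "algebraically_closed k"
    and "ring_char k = 2"
  shows "blocks (group_algebra k (alt_group 4)) = {carrier (group_algebra k (alt_group 4))}"
proof -
  interpret k: algebraically_closed k by fact
  interpret G: group "alt_group 4" by (rule alt_group_is_group)
  interpret V: normal klein_four "alt_group 4" by (rule klein_four_normal)
  let ?A = "group_algebra k (alt_group 4)"
  have fin: "finite (carrier (alt_group 4))"
    using finite_permutations[of "{1..4::nat}"]
    by (rule finite_subset[rotated]) (auto simp: alt_group_carrier)
  have "add_pow k (2::nat) \<one>\<^bsub>k\<^esub> = \<zero>\<^bsub>k\<^esub>"
    using k.add.pow_eq_id[of "\<one>\<^bsub>k\<^esub>" 2] assms(2) by (simp add: ring_char_def)
  then have char2: "\<one>\<^bsub>k\<^esub> \<oplus>\<^bsub>k\<^esub> \<one>\<^bsub>k\<^esub> = \<zero>\<^bsub>k\<^esub>"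
    by (simp add: numeral_2_eq_2)
  have idem: "e = \<zero>\<^bsub>?A\<^esub> \<or> e = \<one>\<^bsub>?A\<^esub>" if "central_idempotent ?A e" for e
  proof (rule central_idempotent_group_algebra_char2[OF k.domain_axioms char2 G.is_group fin
        V.subgroup_axioms _ _ _ that])
    show "klein_four \<noteq> {\<one>\<^bsub>alt_group 4\<^esub>}"
      using klein_four_nontrivial by (simp add: alt_group_one)
    show "v \<otimes>\<^bsub>alt_group 4\<^esub> v = \<one>\<^bsub>alt_group 4\<^esub>" if "v \<in> klein_four" for v
      using that unfolding klein_four_def alt_group_mult alt_group_one by blast
    show "\<exists>u\<in>carrier (alt_group 4).
        x \<otimes>\<^bsub>alt_group 4\<^esub> v = inv\<^bsub>alt_group 4\<^esub> u \<otimes>\<^bsub>alt_group 4\<^esub> (x \<otimes>\<^bsub>alt_group 4\<^esub> u)"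
      if x: "x \<in> carrier (alt_group 4) - klein_four" and v: "v \<in> klein_four" for x v
    proof -
      have "\<exists>u\<in>klein_four.
          x \<otimes>\<^bsub>alt_group 4\<^esub> v = inv\<^bsub>alt_group 4\<^esub> u \<otimes>\<^bsub>alt_group 4\<^esub> (x \<otimes>\<^bsub>alt_group 4\<^esub> u)"
      proof (rule V.coset_conjugate)
        show "finite klein_four" using fin V.subset by (rule finite_subset[rotated])
        show "u = \<one>\<^bsub>alt_group 4\<^esub>"
          if "u \<in> klein_four" "u \<otimes>\<^bsub>alt_group 4\<^esub> x = x \<otimes>\<^bsub>alt_group 4\<^esub> u" for u
          using klein_four_commute[OF x] that by (simp add: alt_group_mult alt_group_one)
      qed (use x v in auto)
      then show ?thesis using V.subset by blast
    qed
  qed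
  interpret A: ring ?A by (rule group_algebra_ring[OF k.is_cring G.is_group fin])
  have "\<one>\<^bsub>?A\<^esub> \<one>\<^bsub>alt_group 4\<^esub> \<noteq> \<zero>\<^bsub>?A\<^esub> \<one>\<^bsub>alt_group 4\<^esub>"
    by (simp add: group_algebra_def)
  then have "\<one>\<^bsub>?A\<^esub> \<noteq> \<zero>\<^bsub>?A\<^esub>" by metis
  then show ?thesis by (rule A.blocks_trivial_idempotents) (rule idem)
qed

end
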